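(* Let $L$ be a prime power such that $p=L^2+L+1$ is a prime. Then the IDEAL-CH algorithm (described in the context) constructs a channel hopping sequence $\{c(t),\ 0\le t\le 2p^2-1\}$ with period $2p^2=2(L^2+L+1)^2$ that achieves maximum rendezvous diversity for the $L^2$ channels $\{0,1,\dots,L^2-1\}$. That is, $c(t)\in\{0,\dots,L^2-1\}$ for all $t$, and for every time shift $0\le d\le 2p^2-1$ and every channel $0\le k\le L^2-1$ there exists $0\le t\le 2p^2-1$ such that $c(t)=c((t+d)\bmod 2p^2)=k$.
   Context: Throughout, $\oplus$ denotes addition modulo $p$, matrix rows and columns are indexed by $0,1,\dots,p-1$, and $Z_p=\{0,1,\dots,p-1\}$. **Ideal matrix.** A $(0,1)$ matrix $M=(m_{i,j})$ of size $p\times p$ is ideal if (i) each column contains exactly one $1$; and (ii) $\rho(\delta,\tau)=\sum_{i=0}^{p-1}\sum_{j=0}^{p-1}m_{i\oplus\delta,j\oplus\tau}\,m_{i,j}$ satisfies $\rho(\delta,\tau)\le 1$ for all $0\le\delta,\tau\le p-1$ with $(\delta,\tau)\neq(0,0)$. (For $p$ prime such matrices are known to exist by the Elliott–Butson construction.) **Perfect difference set.** A set $D\subset Z_p$ is a perfect difference set in $Z_p$ if for every $\ell\not\equiv 0 \pmod p$ there is exactly one ordered pair $(a,a')\in D\times D$ with $a-a'\equiv \ell\pmod p$. When $p=L^2+L+1$ such a set has $L+1$ elements (for $L$ a prime power it is known to exist by Singer's construction). **IDEAL-CH algorithm.** Input: $L$ a prime power with $p=L^2+L+1$ prime. 1.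 Construct a $p\times p$ ideal matrix $M=(m_{i,j})$. 2. Construct $\tilde M=(\tilde m_{i,j})$ by replacing, for each $j$, column $j$ of $M$ by the $(p-i)$-th rotation of $(0,1,\dots,p-1)$, where $i$ is the unique row with $m_{i,j}=1$; that is, $\tilde m_{i',j}=(i'+p-i) \bmod p$ for all $i'$. 3. Construct a perfect difference set $D=\{a_0,\dots,a_L\}$ in $Z_p$. 4. Let $D^c=Z_p\setminus D=\{b_0,b_1,\dots,b_{L^2-1}\}$. 5. Let $C=(c_{i,j})$ with $c_{i,j}=(j \bmod L^2)$ if $\tilde m_{i,j}\in D$, and $c_{i,j}=\ell$ if $\tilde m_{i,j}=b_\ell$. 6. For $t=0,1,\dots,2p^2-1$, output $c(t)=c_{i,j}$ with $i=\lfloor t/(2p)\rfloor$ and $j=(t\bmod p)$. The choices of $M$, $D$ and the enumeration of $D^c$ are arbitrary; the claim is for every such choice. *)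

theory Defs
  imports "HOL-Number_Theory.Number_Theory"
begin

text \<open>A \<open>p \<times> p\<close> matrix is a function \<open>nat \<Rightarrow> nat \<Rightarrow> nat\<close> (row, then column), of which
  only the entries with both indices below \<open>p\<close> are relevant.\<close>

definition autocorrelation :: "nat \<Rightarrow> (nat \<Rightarrow> nat \<Rightarrow> nat) \<Rightarrow> nat \<Rightarrow> nat \<Rightarrow> nat" where
  "autocorrelation p m \<delta> \<tau> =
    (\<Sum>i<p. \<Sum>j<p. m ((i + \<delta>) mod p) ((j + \<tau>) mod p) * m i j)"

definition ideal_matrix :: "nat \<Rightarrow> (nat \<Rightarrow> nat \<Rightarrow> nat) \<Rightarrow> bool" where
  "ideal_matrix p m \<longleftrightarrow>
    (\<forall>i<p. \<forall>j<p. m i j \<in> {0, 1}) \<and>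
    (\<forall>j<p. \<exists>!i. i < p \<and> m i j = 1) \<and>
    (\<forall>\<delta><p. \<forall>\<tau><p. (\<delta>, \<tau>) \<noteq> (0, 0) \<longrightarrow> autocorrelation p m \<delta> \<tau> \<le> 1)"

definition perfect_difference_set :: "nat \<Rightarrow> nat set \<Rightarrow> bool" where
  "perfect_difference_set p D \<longleftrightarrow>
    D \<subseteq> {..<p} \<and>
    (\<forall>l::int. \<not> [l = 0] (mod int p) \<longrightarrow>
      (\<exists>!q. q \<in> D \<times> D \<and> [int (fst q) - int (snd q) = l] (mod int p)))"

definition rotated_matrix :: "nat \<Rightarrow> (nat \<Rightarrow> nat \<Rightarrow> nat) \<Rightarrow> nat \<Rightarrow> nat \<Rightarrow> nat" where
  "rotated_matrix p m i' j = (i' + p - (THE i. i < p \<and> m i j = 1)) mod p"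

text \<open>Here \<open>b\<close> enumerates the complement of \<open>D\<close> in \<open>{..<p}\<close> by the indices below \<open>L\<^sup>2\<close>.\<close>

definition channel_matrix ::
  "nat \<Rightarrow> nat \<Rightarrow> (nat \<Rightarrow> nat \<Rightarrow> nat) \<Rightarrow> nat set \<Rightarrow> (nat \<Rightarrow> nat) \<Rightarrow> nat \<Rightarrow> nat \<Rightarrow> nat" where
  "channel_matrix L p m D b i j =
    (if rotated_matrix p m i j \<in> D then j mod L\<^sup>2
     else (THE l. l < L\<^sup>2 \<and> b l = rotated_matrix p m i j))"

text \<open>The output of the algorithm is \<open>ideal_CH L p m D b t\<close> for \<open>t < 2 * p\<^sup>2\<close>.\<close>

definition ideal_CH ::
  "nat \<Rightarrow> nat \<Rightarrow> (nat \<Rightarrow> nat \<Rightarrow> nat) \<Rightarrow> nat set \<Rightarrow> (nat \<Rightarrow> nat) \<Rightarrow> nat \<Rightarrow> nat" where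
  "ideal_CH L p m D b t = channel_matrix L p m D b (t div (2 * p)) (t mod p)"

text \<open>A channel hopping sequence of period \<open>T\<close> on the channels \<open>{..<N}\<close> is given by one period
  \<open>c 0, \<dots>, c (T - 1)\<close>; its periodic continuation is expressed by reducing time modulo \<open>T\<close>.\<close>

definition CH_sequence :: "nat \<Rightarrow> nat \<Rightarrow> (nat \<Rightarrow> nat) \<Rightarrow> bool" where
  "CH_sequence N T c \<longleftrightarrow> (\<forall>t<T. c t < N)"

definition max_rendezvous_diversity :: "nat \<Rightarrow> nat \<Rightarrow> (nat \<Rightarrow> nat) \<Rightarrow> bool" where
  "max_rendezvous_diversity N T c \<longleftrightarrow>
    (\<forall>d<T. \<forall>k<N. \<exists>t<T. c t = k \<and> c ((t + d) mod T) = k)"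

end

(* Let h j be the row of the 1 in column j of M. A time shift by d = 2 p e + r aligns, within
   one of the two traversals of each row, every matrix position (i, j) with
   (i + \<delta>, j + \<tau>), where \<tau> = r mod p and \<delta> is e or e + 1. If \<tau> \<noteq> 0, ideality makes
   j \<mapsto> h (j + \<tau>) - h j injective, hence bijective, on Z_p; a column j where it takes the value
   \<delta> contains a rendezvous on every channel k, namely in the row b k + h j. If \<tau> = 0 \<noteq> \<delta>, write
   \<delta> = a - a' with a, a' \<in> D; then the row a' + h k of column k is a rendezvous on channel k. *)
theory Submission
  imports Defs
begin

section \<open>Rows of the ones in an ideal matrix\<close>

definition one_row :: "nat \<Rightarrow> (nat \<Rightarrow> nat \<Rightarrow> nat) \<Rightarrow> nat \<Rightarrow> nat" where
  "one_row p m j = (THE i. i < p \<and> m i j = 1)"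

lemma one_row:
  assumes "ideal_matrix p m" and "j < p"
  shows one_row_less: "one_row p m j < p" and one_row_entry: "m (one_row p m j) j = 1"
proof -
  have "\<exists>!i. i < p \<and> m i j = 1"
    using assms by (simp add: ideal_matrix_def)
  from theI'[OF this] show "one_row p m j < p" and "m (one_row p m j) j = 1"
    by (simp_all add: one_row_def)
qed

lemma add_mod_diff_mod_cancel:
  fixes p x y :: nat
  assumes "x < p" and "y < p"
  shows "(x + (y + p - x) mod p) mod p = y"
proof -
  have "(x + (y + p - x) mod p) mod p = (x + (y + p - x)) mod p"
    by (simp add: mod_add_right_eq)
  also have "x + (y + p - x) = y + p"
    using assms by simp
  finally show ?thesis
    using assms by simp
qed

lemma mod_add_diff_mod_cancel:
  fixes p x y :: nat
  assumes "x \<le> p"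
  shows "((x + y) mod p + p - x) mod p = y mod p"
proof -
  have "((x + y) mod p + p - x) mod p = ((x + y) mod p + (p - x)) mod p"
    using assms by simp
  also have "\<dots> = (x + y + (p - x)) mod p"
    by (simp add: mod_add_left_eq)
  also have "x + y + (p - x) = y + p"
    using assms by simp
  finally show ?thesis by simp
qed

text \<open>Moving the 1 of a column \<open>j\<close> by its own difference and by \<tau> lands on
  the 1 of column \<open>(j + \<tau>) mod p\<close>. Two columns with the same difference \<delta>
  would thus contribute two unit terms to the autocorrelation at \<open>(\<delta>, \<tau>)\<close>,
  where \<tau> > 0 bounds it by 1.\<close>

lemma ideal_matrix_differences_inj:
  assumes ideal: "ideal_matrix p m" and \<tau>: "0 < \<tau>" "\<tau> < p"
  shows "inj_on (\<lambda>j. (one_row p m ((j + \<tau>) mod p) + p - one_row p m j) mod p) {..<p}"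
proof (rule inj_onI, rule ccontr)
  let ?h = "one_row p m"
  let ?\<delta> = "\<lambda>j. (?h ((j + \<tau>) mod p) + p - ?h j) mod p"
  fix x y
  assume xy: "x \<in> {..<p}" "y \<in> {..<p}" "?\<delta> x = ?\<delta> y" "x \<noteq> y"
  let ?f = "\<lambda>(i, j). m ((i + ?\<delta> x) mod p) ((j + \<tau>) mod p) * m i j"
  have p: "0 < p" using \<tau> by simp
  have one: "?f (?h j, j) = 1" if "j < p" "?\<delta> j = ?\<delta> x" for j
  proof -
    have "(?h j + ?\<delta> x) mod p = ?h ((j + \<tau>) mod p)"
      unfolding that(2)[symmetric]
      by (rule add_mod_diff_mod_cancel) (use that p one_row_less[OF ideal] in simp_all)
    then show ?thesis
      using that p one_row_entry[OF ideal] by simp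
  qed
  have "2 = sum ?f {(?h x, x), (?h y, y)}"
    using one[of x] one[of y] xy by simp
  also have "\<dots> \<le> sum ?f ({..<p} \<times> {..<p})"
    by (rule sum_mono2) (use xy one_row_less[OF ideal] in auto)
  also have "\<dots> = autocorrelation p m (?\<delta> x) \<tau>"
    by (simp add: autocorrelation_def sum.cartesian_product)
  also have "\<dots> \<le> 1"
    using ideal \<tau> p by (simp add: ideal_matrix_def)
  finally show False by simp
qed

lemma ideal_matrix_difference_attained:
  assumes ideal: "ideal_matrix p m" and "0 < \<tau>" "\<tau> < p" and "\<delta> < p"
  shows "\<exists>j<p. one_row p m ((j + \<tau>) mod p) = (one_row p m j + \<delta>) mod p"
proof -
  let ?\<delta> = "\<lambda>j. (one_row p m ((j + \<tau>) mod p) + p - one_row p m j) mod p"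
  have "?\<delta> ` {..<p} = {..<p}"
  proof (rule endo_inj_surj)
    show "?\<delta> ` {..<p} \<subseteq> {..<p}"
      using \<open>\<delta> < p\<close> by auto
    show "inj_on ?\<delta> {..<p}"
      by (rule ideal_matrix_differences_inj) fact+
  qed simp
  moreover have "\<delta> \<in> {..<p}"
    using \<open>\<delta> < p\<close> by simp
  ultimately have "\<delta> \<in> ?\<delta> ` {..<p}"
    by (simp only:)
  then obtain j where j: "j < p" "\<delta> = ?\<delta> j"
    by (elim imageE) (simp only: lessThan_iff)
  have "(one_row p m j + \<delta>) mod p = one_row p m ((j + \<tau>) mod p)"
    unfolding j(2)
    by (rule add_mod_diff_mod_cancel) (use j(1) one_row_less[OF ideal] in simp_all)
  with j(1) show ?thesis by auto
qed

section \<open>Entries of the rotated and channel matrices\<close>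

text \<open>Each rotated column counts 0, 1, ..., p - 1 cyclically downwards from the row of its 1,
  so a value is located by its distance below that row.\<close>

lemma rotated_matrix_at:
  assumes "ideal_matrix p m" and "j < p"
  shows "rotated_matrix p m ((one_row p m j + a) mod p) j = a mod p"
  using mod_add_diff_mod_cancel[of "one_row p m j" p a] one_row_less[OF assms]
  by (simp add: rotated_matrix_def one_row_def)

lemma channel_matrix_complement:
  assumes b: "bij_betw b {..<L\<^sup>2} ({..<p} - D)"
    and "k < L\<^sup>2" and "rotated_matrix p m i j = b k"
  shows "channel_matrix L p m D b i j = k"
proof -
  have "b k \<notin> D"
    using b \<open>k < L\<^sup>2\<close> by (auto simp: bij_betw_def)
  moreover have "(THE l. l < L\<^sup>2 \<and> b l = b k) = k"
    using b \<open>k < L\<^sup>2\<close> by (auto simp: bij_betw_def inj_on_def)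
  ultimately show ?thesis
    using assms by (simp add: channel_matrix_def)
qed

lemma channel_matrix_less:
  assumes b: "bij_betw b {..<L\<^sup>2} ({..<p} - D)" and "0 < L" and "0 < p"
  shows "channel_matrix L p m D b i j < L\<^sup>2"
proof (cases "rotated_matrix p m i j \<in> D")
  case True
  then show ?thesis
    using \<open>0 < L\<close> by (simp add: channel_matrix_def)
next
  case False
  then have "rotated_matrix p m i j \<in> b ` {..<L\<^sup>2}"
    using b \<open>0 < p\<close> by (auto simp: bij_betw_def rotated_matrix_def)
  then obtain k where "k < L\<^sup>2" "rotated_matrix p m i j = b k"
    by auto
  then show ?thesis
    using channel_matrix_complement[OF b] by simp
qed

text \<open>Turns the integer congruence for differences into an additive equation on residues, the
  form in which a cyclic row shift by \<delta> carries the entry \<open>a'\<close> of a column to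
  the entry \<open>a\<close>.\<close>

lemma perfect_difference_set_obtain:
  assumes "perfect_difference_set p D" and "0 < \<delta>" "\<delta> < p"
  obtains a a' where "a \<in> D" "a' \<in> D" "a < p" "a' < p" "(a' + \<delta>) mod p = a"
proof -
  have "\<not> [int \<delta> = 0] (mod int p)"
    using assms by (simp add: cong_def)
  with assms(1) have "\<exists>!q. q \<in> D \<times> D \<and> [int (fst q) - int (snd q) = int \<delta>] (mod int p)"
    unfolding perfect_difference_set_def by blast
  then obtain q where q: "q \<in> D \<times> D" "[int (fst q) - int (snd q) = int \<delta>] (mod int p)"
    by (elim ex1E) blast
  obtain a a' where "q = (a, a')"
    by (cases q)
  with q have D: "a \<in> D" "a' \<in> D" and cong: "[int a - int a' = int \<delta>] (mod int p)"
    by simp_all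
  have less: "a < p" "a' < p"
    using D assms(1) by (auto simp: perfect_difference_set_def)
  have "[int a = int (a' + \<delta>)] (mod int p)"
    using cong_add[OF cong cong_refl[of "int a'"]] by (simp add: add.commute)
  then have "[a = a' + \<delta>] (mod p)"
    by (simp only: cong_int_iff)
  then have "(a' + \<delta>) mod p = a"
    using less by (simp add: cong_def)
  with D less that show thesis by blast
qed

lemma channel_matrix_rendezvous:
  assumes ideal: "ideal_matrix p m" and D: "perfect_difference_set p D"
    and b: "bij_betw b {..<L\<^sup>2} ({..<p} - D)"
    and "L\<^sup>2 \<le> p" and "\<delta> < p" and "\<tau> < p" and k: "k < L\<^sup>2"
  shows "\<exists>i<p. \<exists>j<p. channel_matrix L p m D b i j = k \<and>
    channel_matrix L p m D b ((i + \<delta>) mod p) ((j + \<tau>) mod p) = k"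
proof -
  let ?h = "one_row p m" and ?C = "channel_matrix L p m D b"
  have p: "0 < p" using \<open>\<delta> < p\<close> by simp
  have bk: "b k < p"
    using b k by (auto simp: bij_betw_def)
  have rendezvous: ?thesis
    if "i < p" "j < p" "?C i j = k" "?C ((i + \<delta>) mod p) ((j + \<tau>) mod p) = k" for i j
    using that by blast
  consider "\<tau> > 0" | "\<tau> = 0" "\<delta> = 0" | "\<tau> = 0" "\<delta> > 0" by blast
  then show ?thesis
  proof cases
    case 1
    obtain j where j: "j < p" "?h ((j + \<tau>) mod p) = (?h j + \<delta>) mod p"
      using ideal_matrix_difference_attained[OF ideal 1 \<open>\<tau> < p\<close> \<open>\<delta> < p\<close>] by blast
    \<comment> \<open>In both columns \<open>j\<close> and \<open>j + \<tau>\<close> the value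
      \<open>b k\<close> lies \<open>b k\<close> rows below the 1, and the two 1s are \<delta> rows
      apart, so the shift carries one occurrence to the other.\<close>
    let ?i = "(?h j + b k) mod p"
    have "(?i + \<delta>) mod p = (?h ((j + \<tau>) mod p) + b k) mod p"
      unfolding j(2) by (simp add: mod_simps ac_simps)
    then have "rotated_matrix p m ((?i + \<delta>) mod p) ((j + \<tau>) mod p) = b k"
      using rotated_matrix_at[OF ideal, of "(j + \<tau>) mod p" "b k"] p bk by simp
    moreover have "rotated_matrix p m ?i j = b k"
      using rotated_matrix_at[OF ideal j(1)] bk by simp
    ultimately have "?C ?i j = k" "?C ((?i + \<delta>) mod p) ((j + \<tau>) mod p) = k"
      using channel_matrix_complement[OF b k] by simp_all
    moreover have "?i < p" using p by simp
    ultimately show ?thesis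
      by (intro rendezvous[OF _ j(1)])
  next
    case 2
    \<comment> \<open>Under the zero shift any single occurrence of channel \<open>k\<close> meets
      itself; column 0 is an arbitrary choice.\<close>
    let ?i = "(?h 0 + b k) mod p"
    have "rotated_matrix p m ?i 0 = b k"
      using rotated_matrix_at[OF ideal p] bk by simp
    then have "?C ?i 0 = k"
      by (rule channel_matrix_complement[OF b k])
    with p 2 show ?thesis
      by (intro rendezvous[of ?i 0]) simp_all
  next
    case 3
    obtain a a' where a: "a \<in> D" "a' \<in> D" "a < p" "a' < p" "(a' + \<delta>) mod p = a"
      using perfect_difference_set_obtain[OF D 3(2) \<open>\<delta> < p\<close>] .
    let ?i = "(?h k + a') mod p"
    \<comment> \<open>Column \<open>k\<close> exists, and since \<open>k mod L\<^sup>2 = k\<close>,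
      its entries with rotated value in \<open>D\<close> all carry channel \<open>k\<close>.\<close>
    have kp: "k < p" using k \<open>L\<^sup>2 \<le> p\<close> by simp
    have "(?i + \<delta>) mod p = (?h k + (a' + \<delta>)) mod p"
      by (simp add: mod_simps ac_simps)
    then have "rotated_matrix p m ((?i + \<delta>) mod p) k = a"
      using rotated_matrix_at[OF ideal kp, of "a' + \<delta>"] a by simp
    moreover have "rotated_matrix p m ?i k = a'"
      using rotated_matrix_at[OF ideal kp] a by simp
    ultimately have "?C ?i k = k" "?C ((?i + \<delta>) mod p) k = k"
      using a(1,2) k by (simp_all add: channel_matrix_def)
    moreover have "(k + \<tau>) mod p = k" using 3 kp by simp
    moreover have "?i < p" using p by simp
    ultimately show ?thesis
      by (intro rendezvous[OF _ kp]) (simp_all only:)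
  qed
qed

section \<open>Time shifts as cyclic shifts of the matrix\<close>

text \<open>Wrapping around at the end of the sequence becomes a wrap from the last row to row 0,
  while the column is unaffected because p divides the period.\<close>

lemma ideal_CH_mod_period:
  "ideal_CH L p m D b (t mod (2 * p\<^sup>2)) = channel_matrix L p m D b (t div (2 * p) mod p) (t mod p)"
proof (cases "p = 0")
  case True
  then show ?thesis by (simp add: ideal_CH_def)
next
  case False
  have "t mod (2 * p\<^sup>2) = 2 * p * (t div (2 * p) mod p) + t mod (2 * p)"
    using mod_mult2_eq[of t "2 * p" p] by (simp add: power2_eq_square mult.assoc)
  moreover have "t mod (2 * p\<^sup>2) mod p = t mod p"
    by (simp add: mod_mod_cancel)
  ultimately show ?thesis
    using False by (simp add: ideal_CH_def)
qed

lemma ideal_CH_shift_aligns: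
  fixes p d :: nat
  assumes p: "0 < p"
  shows "\<exists>\<delta><p. \<exists>\<tau><p. \<forall>i<p. \<forall>j<p. \<exists>t<2 * p\<^sup>2.
    ideal_CH L p m D b t = channel_matrix L p m D b i j \<and>
    ideal_CH L p m D b ((t + d) mod (2 * p\<^sup>2)) =
      channel_matrix L p m D b ((i + \<delta>) mod p) ((j + \<tau>) mod p)"
proof -
  define e r where "e = d div (2 * p)" and "r = d mod (2 * p)"
  have d: "d = 2 * p * e + r" by (simp add: e_def r_def)
  have r: "r < 2 * p" using p by (simp add: r_def)
  \<comment> \<open>The first traversal of row \<open>i\<close> is used if \<open>r \<le> p\<close> and the second one otherwise; in both
    cases the shifted times lie in a single row.\<close>
  define o\<^sub>1 where "o\<^sub>1 = (if r \<le> p then 0 else p)"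
  define \<epsilon> where "\<epsilon> = (if r \<le> p then 0 else 1 :: nat)"
  have shifted: "(t + d) div (2 * p) = i + (e + \<epsilon>)" "(t + d) mod p = (j + r) mod p"
    if "j < p" "t = 2 * p * i + (j + o\<^sub>1)" for i j t
  proof -
    \<comment> \<open>\<open>q\<close> is the offset of the shifted time within its block of length
      2p. The subtraction does not truncate: if \<epsilon> = 1, then r > p and
      \<open>o\<^sub>1\<close> = p.\<close>
    define q where "q = j + o\<^sub>1 + r - 2 * p * \<epsilon>"
    have "j + o\<^sub>1 + r = 2 * p * \<epsilon> + q" and q: "q < 2 * p"
      using that r by (auto simp: q_def o\<^sub>1_def \<epsilon>_def)
    then have "t + d = 2 * p * (i + (e + \<epsilon>)) + q"
      using that d by (simp add: algebra_simps)
    then show "(t + d) div (2 * p) = i + (e + \<epsilon>)"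
      using q p by simp
    \<comment> \<open>Since \<open>o\<^sub>1\<close> equals \<open>p * \<epsilon>\<close>, the
      choice of traversal leaves the column unchanged.\<close>
    have "t + d = j + r + p * (2 * i + 2 * e + \<epsilon>)"
      using that d by (auto simp: o\<^sub>1_def \<epsilon>_def algebra_simps)
    then show "(t + d) mod p = (j + r) mod p" by simp
  qed
  have "\<exists>t<2 * p\<^sup>2. ideal_CH L p m D b t = channel_matrix L p m D b i j \<and>
      ideal_CH L p m D b ((t + d) mod (2 * p\<^sup>2)) =
        channel_matrix L p m D b ((i + (e + \<epsilon>) mod p) mod p) ((j + r mod p) mod p)"
    if ij: "i < p" "j < p" for i j
  proof -
    define t where "t = 2 * p * i + (j + o\<^sub>1)"
    have o: "j + o\<^sub>1 < 2 * p" using ij by (simp add: o\<^sub>1_def)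
    have "t < 2 * p * Suc i" using o by (simp add: t_def)
    also have "\<dots> \<le> 2 * p * p" using ij by (intro mult_le_mono2) simp
    finally have "t < 2 * p\<^sup>2" by (simp add: power2_eq_square)
    moreover have "t div (2 * p) = i" using o p by (simp add: t_def)
    moreover have "t mod p = j"
    proof -
      have "t = j + p * (2 * i + \<epsilon>)" by (simp add: t_def o\<^sub>1_def \<epsilon>_def algebra_simps)
      then show ?thesis using ij by simp
    qed
    ultimately show ?thesis
      using shifted[OF ij(2) t_def]
      by (intro exI[of _ t]) (simp add: ideal_CH_mod_period mod_simps, simp add: ideal_CH_def)
  qed
  moreover have "(e + \<epsilon>) mod p < p" "r mod p < p" using p by simp_all
  ultimately show ?thesis by blast
qed

theorem corollary8:
  fixes L p :: nat and M :: "nat \<Rightarrow> nat \<Rightarrow> nat" and D :: "nat set" and b :: "nat \<Rightarrow> nat"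
  assumes "primepow L"
    and "p = L\<^sup>2 + L + 1"
    and "prime p"
    and "ideal_matrix p M"
    and "perfect_difference_set p D"
    and "bij_betw b {..<L\<^sup>2} ({..<p} - D)"
  shows "CH_sequence (L\<^sup>2) (2 * p\<^sup>2) (ideal_CH L p M D b)
    \<and> max_rendezvous_diversity (L\<^sup>2) (2 * p\<^sup>2) (ideal_CH L p M D b)"
proof
  have L: "0 < L" using assms(1) by (rule primepow_gt_0_nat)
  have p: "0 < p" "L\<^sup>2 \<le> p" using assms(2) by simp_all
  show "CH_sequence (L\<^sup>2) (2 * p\<^sup>2) (ideal_CH L p M D b)"
    using channel_matrix_less[OF assms(6) L p(1)] by (simp add: CH_sequence_def ideal_CH_def)
  show "max_rendezvous_diversity (L\<^sup>2) (2 * p\<^sup>2) (ideal_CH L p M D b)"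
    unfolding max_rendezvous_diversity_def
  proof (intro allI impI)
    fix d k
    assume k: "k < L\<^sup>2"
    obtain \<delta> \<tau> where "\<delta> < p" "\<tau> < p" and aligned: "\<forall>i<p. \<forall>j<p. \<exists>t<2 * p\<^sup>2.
        ideal_CH L p M D b t = channel_matrix L p M D b i j \<and>
        ideal_CH L p M D b ((t + d) mod (2 * p\<^sup>2)) =
          channel_matrix L p M D b ((i + \<delta>) mod p) ((j + \<tau>) mod p)"
      using ideal_CH_shift_aligns[OF p(1), of L M D b d] by blast
    \<comment> \<open>The position is chosen only after \<open>d\<close> has fixed \<delta> and
      \<tau>; \<open>aligned\<close> then supplies a time that visits it.\<close>
    then obtain i j where "i < p" "j < p" "channel_matrix L p M D b i j = k"
        "channel_matrix L p M D b ((i + \<delta>) mod p) ((j + \<tau>) mod p) = k"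
      using channel_matrix_rendezvous[OF assms(4-6) p(2) _ _ k] by blast
    with aligned show "\<exists>t<2 * p\<^sup>2. ideal_CH L p M D b t = k \<and>
        ideal_CH L p M D b ((t + d) mod (2 * p\<^sup>2)) = k"
      by metis
  qed
qed

end
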